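(* Let $n\ge 2$ and let $\phi_n:T_n\to\operatorname{Aut}(PT_n)$ be the natural homomorphism obtained by restricting the inner automorphisms of $T_n$ to the normal subgroup $PT_n$. Then $\phi_n$ is injective if and only if $n\ge 4$.
   Context: For an integer $n\ge 2$, the twin group $T_n$ is the group generated by $s_1,\dots,s_{n-1}$ with defining relations $s_i^2=1$ for all $i$, and $s_is_j=s_js_i$ whenever $|i-j|\ge 2$. The pure twin group $PT_n$ is the kernel of the homomorphism $\pi:T_n\to S_n$ to the symmetric group on $n$ symbols that maps each $s_i$ to the transposition $(i,\,i+1)$. The inner automorphism induced by $g$ is $x\mapsto g^{-1}xg$, and the product in $\operatorname{Aut}(PT_n)$ is composed in the order that makes $g\mapsto (x\mapsto g^{-1}xg)$ a homomorphism. *)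

theory Defs
  imports "HOL-Algebra.Sym_Groups" "HOL-Algebra.Bij"
begin

section \<open>Groups given by generators and relations\<close>

text \<open>A letter \<open>(x, True)\<close> stands for the generator \<open>x\<close>, and \<open>(x, False)\<close> for its formal inverse.\<close>

type_synonym 'a group_word = "('a \<times> bool) list"

abbreviation group_words :: "'a set \<Rightarrow> 'a group_word set"
  where "group_words S \<equiv> lists (S \<times> UNIV)"

text \<open>The smallest congruence on words over \<open>S\<close> that contains free cancellation and identifies the
  two sides of every relation \<open>u = v\<close>, encoded as a pair \<open>(u, v) \<in> R\<close>.\<close>

inductive_set word_cong :: "'a set \<Rightarrow> ('a group_word \<times> 'a group_word) set \<Rightarrow>
    ('a group_word \<times> 'a group_word) set"
  for S R where
  refl: "w \<in> group_words S \<Longrightarrow> (w, w) \<in> word_cong S R"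
| sym: "(u, v) \<in> word_cong S R \<Longrightarrow> (v, u) \<in> word_cong S R"
| trans: "(u, v) \<in> word_cong S R \<Longrightarrow> (v, w) \<in> word_cong S R \<Longrightarrow> (u, w) \<in> word_cong S R"
| append: "(u, u') \<in> word_cong S R \<Longrightarrow> (v, v') \<in> word_cong S R \<Longrightarrow>
    (u @ v, u' @ v') \<in> word_cong S R"
| cancel: "x \<in> S \<Longrightarrow> ([(x, b), (x, \<not> b)], []) \<in> word_cong S R"
| relation: "(u, v) \<in> R \<Longrightarrow> u \<in> group_words S \<Longrightarrow> v \<in> group_words S \<Longrightarrow>
    (u, v) \<in> word_cong S R"

definition presented_group :: "'a set \<Rightarrow> ('a group_word \<times> 'a group_word) set \<Rightarrow>
    'a group_word set monoid"
  where "presented_group S R =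
    \<lparr>carrier = group_words S // word_cong S R,
     mult = (\<lambda>A B. \<Union>u\<in>A. \<Union>v\<in>B. word_cong S R `` {u @ v}),
     one = word_cong S R `` {[]}\<rparr>"

definition presented_generator :: "'a set \<Rightarrow> ('a group_word \<times> 'a group_word) set \<Rightarrow> 'a \<Rightarrow>
    'a group_word set"
  where "presented_generator S R x = word_cong S R `` {[(x, True)]}"

definition eval_letter :: "('b, 'm) monoid_scheme \<Rightarrow> ('a \<Rightarrow> 'b) \<Rightarrow> 'a \<times> bool \<Rightarrow> 'b"
  where "eval_letter G f l = (if snd l then f (fst l) else inv\<^bsub>G\<^esub> (f (fst l)))"

definition eval_word :: "('b, 'm) monoid_scheme \<Rightarrow> ('a \<Rightarrow> 'b) \<Rightarrow> 'a group_word \<Rightarrow> 'b"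
  where "eval_word G f w = foldr (\<lambda>l g. eval_letter G f l \<otimes>\<^bsub>G\<^esub> g) w \<one>\<^bsub>G\<^esub>"

text \<open>Meaningful when \<open>f\<close> respects the relations: then the image below is a singleton.\<close>

definition presented_lift :: "('b, 'm) monoid_scheme \<Rightarrow> ('a \<Rightarrow> 'b) \<Rightarrow> 'a group_word set \<Rightarrow> 'b"
  where "presented_lift G f A = the_elem (eval_word G f ` A)"

lemma word_cong_words:
  assumes "(u, v) \<in> word_cong S R"
  shows "u \<in> group_words S" "v \<in> group_words S"
  using assms by (induction rule: word_cong.induct) auto

lemma equiv_word_cong: "equiv (group_words S) (word_cong S R)"
  unfolding equiv_def refl_on_def sym_def trans_def
  by (auto dest: word_cong_words intro: word_cong.refl word_cong.sym word_cong.trans)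

lemma presented_mult:
  assumes "u \<in> group_words S" "v \<in> group_words S"
  shows "word_cong S R `` {u} \<otimes>\<^bsub>presented_group S R\<^esub> word_cong S R `` {v}
    = word_cong S R `` {u @ v}"
proof -
  let ?W = "word_cong S R"
  have "?W `` {u' @ v'} = ?W `` {u @ v}" if "u' \<in> ?W `` {u}" "v' \<in> ?W `` {v}" for u' v'
  proof -
    have "(u @ v, u' @ v') \<in> ?W"
      using that by (auto intro: word_cong.append)
    then show ?thesis
      using equiv_class_eq[OF equiv_word_cong] by metis
  qed
  moreover have "u \<in> ?W `` {u}" "v \<in> ?W `` {v}"
    using assms by (auto intro: word_cong.refl)
  ultimately show ?thesis
    unfolding presented_group_def monoid.simps by blast
qed

lemma presented_carrierE:
  assumes "A \<in> carrier (presented_group S R)"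
  obtains u where "u \<in> group_words S" "A = word_cong S R `` {u}"
  using assms unfolding presented_group_def partial_object.simps by (elim quotientE)

lemma presented_carrierI:
  "u \<in> group_words S \<Longrightarrow> word_cong S R `` {u} \<in> carrier (presented_group S R)"
  unfolding presented_group_def by (auto intro: quotientI)

lemma presented_one: "\<one>\<^bsub>presented_group S R\<^esub> = word_cong S R `` {[]}"
  by (simp add: presented_group_def)

lemma inverse_word:
  assumes "w \<in> group_words S"
  shows "\<exists>v\<in>group_words S. (v @ w, []) \<in> word_cong S R"
  using assms
proof (induction w)
  case Nil
  then show ?case by (auto intro!: bexI[of _ "[]"] word_cong.refl)
next
  case (Cons l w)
  then obtain v where v: "v \<in> group_words S" "(v @ w, []) \<in> word_cong S R" by auto
  obtain x b where l: "l = (x, b)" "x \<in> S" using Cons by (cases l) auto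
  have w: "w \<in> group_words S" using Cons by auto
  have "([(x, \<not> b), (x, b)], []) \<in> word_cong S R"
    using word_cong.cancel[of x S "\<not> b" R] l by simp
  then have "(v @ ([(x, \<not> b), (x, b)] @ w), v @ ([] @ w)) \<in> word_cong S R"
    using v(1) w by (intro word_cong.append word_cong.refl)
  then have "((v @ [(x, \<not> b)]) @ l # w, []) \<in> word_cong S R"
    using v(2) l word_cong.trans by fastforce
  then show ?case using v l by (intro bexI[of _ "v @ [(x, \<not> b)]"]) auto
qed

lemma presented_group_is_group: "group (presented_group S R)"
proof (rule groupI)
  let ?G = "presented_group S R"
  show "x \<otimes>\<^bsub>?G\<^esub> y \<in> carrier ?G" if "x \<in> carrier ?G" "y \<in> carrier ?G" for x y
    using that
    by (elim presented_carrierE) (simp add: presented_mult presented_carrierI del: in_lists_conv_set)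
  show "\<one>\<^bsub>?G\<^esub> \<in> carrier ?G"
    unfolding presented_one by (rule presented_carrierI) simp
  show "x \<otimes>\<^bsub>?G\<^esub> y \<otimes>\<^bsub>?G\<^esub> z = x \<otimes>\<^bsub>?G\<^esub> (y \<otimes>\<^bsub>?G\<^esub> z)"
    if xyz: "x \<in> carrier ?G" "y \<in> carrier ?G" "z \<in> carrier ?G" for x y z
  proof -
    from xyz obtain u v w where "u \<in> group_words S" "x = word_cong S R `` {u}"
      "v \<in> group_words S" "y = word_cong S R `` {v}"
      "w \<in> group_words S" "z = word_cong S R `` {w}"
      by (metis presented_carrierE)
    then show ?thesis by (simp add: presented_mult)
  qed
  show "\<one>\<^bsub>?G\<^esub> \<otimes>\<^bsub>?G\<^esub> x = x" if x: "x \<in> carrier ?G" for x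
  proof -
    from x obtain u where "u \<in> group_words S" "x = word_cong S R `` {u}"
      by (rule presented_carrierE)
    then show ?thesis by (simp add: presented_one presented_mult)
  qed
  show "\<exists>y\<in>carrier ?G. y \<otimes>\<^bsub>?G\<^esub> x = \<one>\<^bsub>?G\<^esub>" if x: "x \<in> carrier ?G" for x
  proof -
    from x obtain u where u: "u \<in> group_words S" "x = word_cong S R `` {u}"
      by (rule presented_carrierE)
    obtain v where v: "v \<in> group_words S" "(v @ u, []) \<in> word_cong S R"
      using inverse_word[OF u(1)] by blast
    have "word_cong S R `` {v} \<otimes>\<^bsub>?G\<^esub> x = \<one>\<^bsub>?G\<^esub>"
      using u v equiv_class_eq[OF equiv_word_cong v(2)] by (simp add: presented_one presented_mult)
    then show ?thesis using v(1) by (blast intro: presented_carrierI)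
  qed
qed

context
  fixes G :: "('b, 'm) monoid_scheme" and f :: "'a \<Rightarrow> 'b" and S :: "'a set"
    and R :: "('a group_word \<times> 'a group_word) set"
  assumes G: "group G" and f: "\<And>x. x \<in> S \<Longrightarrow> f x \<in> carrier G"
begin

lemma eval_word_closed: "w \<in> group_words S \<Longrightarrow> eval_word G f w \<in> carrier G"
proof (induction w)
  case Nil
  then show ?case using G by (simp add: eval_word_def group.is_monoid monoid.one_closed)
next
  case (Cons l w)
  interpret group G by (rule G)
  from Cons show ?case using f by (auto simp: eval_word_def eval_letter_def)
qed

lemma eval_word_append:
  assumes "u \<in> group_words S" "v \<in> group_words S"
  shows "eval_word G f (u @ v) = eval_word G f u \<otimes>\<^bsub>G\<^esub> eval_word G f v"
  using assms(1)
proof (induction u)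
  case Nil
  interpret group G by (rule G)
  show ?case using eval_word_closed[OF assms(2)] by (simp add: eval_word_def)
next
  case (Cons l u)
  interpret group G by (rule G)
  have "eval_letter G f l \<in> carrier G" using Cons f by (auto simp: eval_letter_def)
  moreover have "eval_word G f u \<in> carrier G" using Cons eval_word_closed by auto
  ultimately show ?case
    using Cons eval_word_closed[OF assms(2)] by (auto simp: eval_word_def m_assoc)
qed

context
  assumes rel: "\<And>u v. (u, v) \<in> R \<Longrightarrow> eval_word G f u = eval_word G f v"
begin

lemma eval_word_cong:
  assumes "(u, v) \<in> word_cong S R"
  shows "eval_word G f u = eval_word G f v"
  using assms
proof (induction rule: word_cong.induct)
  case (append u u' v v')
  then show ?case
    using word_cong_words[OF append.hyps(1)] word_cong_words[OF append.hyps(2)]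
    by (simp add: eval_word_append)
next
  case (cancel x b)
  interpret group G by (rule G)
  show ?case using f[OF cancel] by (simp add: eval_word_def eval_letter_def)
qed (use rel in auto)

lemma presented_lift_class:
  assumes "u \<in> group_words S"
  shows "presented_lift G f (word_cong S R `` {u}) = eval_word G f u"
proof -
  have "eval_word G f ` (word_cong S R `` {u}) = {eval_word G f u}"
    using assms eval_word_cong by (auto 0 3 intro: word_cong.refl simp: image_iff)
  then show ?thesis by (simp add: presented_lift_def)
qed

lemma presented_lift_hom: "presented_lift G f \<in> hom (presented_group S R) G"
  by (rule homI; elim presented_carrierE)
    (auto simp: presented_mult presented_lift_class eval_word_append
      simp del: in_lists_conv_set intro: eval_word_closed)

lemma presented_lift_generator:
  assumes "x \<in> S"
  shows "presented_lift G f (presented_generator S R x) = f x"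
proof -
  interpret group G by (rule G)
  show ?thesis
    using assms f
    by (simp add: presented_generator_def presented_lift_class eval_word_def eval_letter_def)
qed

end

end


section \<open>Twin groups and pure twin groups\<close>

definition twin_relations :: "nat \<Rightarrow> (nat group_word \<times> nat group_word) set"
  where "twin_relations n =
    {([(i, True), (i, True)], []) | i. i \<in> {1..<n}} \<union>
    {([(i, True), (j, True)], [(j, True), (i, True)]) | i j.
      i \<in> {1..<n} \<and> j \<in> {1..<n} \<and> \<bar>int i - int j\<bar> \<ge> 2}"

definition twin_group :: "nat \<Rightarrow> nat group_word set monoid"
  where "twin_group n = presented_group {1..<n} (twin_relations n)"

definition twin_generator :: "nat \<Rightarrow> nat \<Rightarrow> nat group_word set"
  where "twin_generator n = presented_generator {1..<n} (twin_relations n)"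

definition twin_perm :: "nat \<Rightarrow> nat group_word set \<Rightarrow> nat \<Rightarrow> nat"
  where "twin_perm n = presented_lift (sym_group n) (\<lambda>i. transpose i (i + 1))"

definition pure_twin_group :: "nat \<Rightarrow> nat group_word set monoid"
  where "pure_twin_group n =
    (twin_group n)\<lparr>carrier := kernel (twin_group n) (sym_group n) (twin_perm n)\<rparr>"

text \<open>In \<open>AutoGroup\<close> the product of \<open>g\<close> and \<open>f\<close> is \<open>g\<close> after \<open>f\<close>; with the convention
  \<open>x \<mapsto> g\<inverse> x g\<close> for inner automorphisms the opposite order is needed.\<close>

definition aut_pure_twin_group :: "nat \<Rightarrow> (nat group_word set \<Rightarrow> nat group_word set) monoid"
  where "aut_pure_twin_group n = (AutoGroup (pure_twin_group n))
    \<lparr>mult := (\<lambda>f g. g \<otimes>\<^bsub>AutoGroup (pure_twin_group n)\<^esub> f)\<rparr>"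

definition twin_conj :: "nat \<Rightarrow> nat group_word set \<Rightarrow> nat group_word set \<Rightarrow> nat group_word set"
  where "twin_conj n g = (\<lambda>x\<in>carrier (pure_twin_group n).
    inv\<^bsub>twin_group n\<^esub> g \<otimes>\<^bsub>twin_group n\<^esub> x \<otimes>\<^bsub>twin_group n\<^esub> g)"

lemma twin_group_is_group: "group (twin_group n)"
  unfolding twin_group_def by (rule presented_group_is_group)

lemma transpose_in_sym_group:
  "i \<in> {1..<n} \<Longrightarrow> transpose i (i + 1) \<in> carrier (sym_group n)"
  by (auto simp: sym_group_carrier intro!: permutes_swap_id)

lemma transposes_respect_twin_relations:
  "(u, v) \<in> twin_relations n \<Longrightarrow>
    eval_word (sym_group n) (\<lambda>i. transpose i (i + 1)) u =
    eval_word (sym_group n) (\<lambda>i. transpose i (i + 1)) v"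
  by (auto simp: twin_relations_def eval_word_def eval_letter_def sym_group_mult sym_group_one
      fun_eq_iff Transposition.transpose_def)

lemma twin_perm_hom: "twin_perm n \<in> hom (twin_group n) (sym_group n)"
  unfolding twin_perm_def twin_group_def
  by (intro presented_lift_hom sym_group_is_group transpose_in_sym_group
      transposes_respect_twin_relations)

lemma twin_perm_generator:
  "i \<in> {1..<n} \<Longrightarrow> twin_perm n (twin_generator n i) = transpose i (i + 1)"
  unfolding twin_perm_def twin_generator_def
  by (intro presented_lift_generator sym_group_is_group transpose_in_sym_group
      transposes_respect_twin_relations)

lemma pure_twin_group_normal: "carrier (pure_twin_group n) \<lhd> twin_group n"
proof -
  interpret group_hom "twin_group n" "sym_group n" "twin_perm n"
    by (intro group_hom.intro group_hom_axioms.intro twin_group_is_group sym_group_is_group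
        twin_perm_hom)
  show ?thesis using normal_kernel by (simp add: pure_twin_group_def)
qed

lemma twin_conj_hom: "twin_conj n \<in> hom (twin_group n) (aut_pure_twin_group n)"
proof -
  let ?T = "twin_group n" and ?P = "pure_twin_group n"
  interpret N: normal "carrier ?P" ?T by (rule pure_twin_group_normal)
  have P_mult: "mult ?P = mult ?T" by (simp add: pure_twin_group_def)
  have sub: "x \<in> carrier ?T" if "x \<in> carrier ?P" for x
    using that N.subset by auto
  have closed: "inv\<^bsub>?T\<^esub> g \<otimes>\<^bsub>?T\<^esub> x \<otimes>\<^bsub>?T\<^esub> g \<in> carrier ?P"
    if "g \<in> carrier ?T" "x \<in> carrier ?P" for g x
    using that N.inv_op_closed1 by simp
  have closed': "g \<otimes>\<^bsub>?T\<^esub> x \<otimes>\<^bsub>?T\<^esub> inv\<^bsub>?T\<^esub> g \<in> carrier ?P"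
    if "g \<in> carrier ?T" "x \<in> carrier ?P" for g x
    using that N.inv_op_closed2 by simp
  have comp: "twin_conj n (g \<otimes>\<^bsub>?T\<^esub> h) = compose (carrier ?P) (twin_conj n h) (twin_conj n g)"
    if "g \<in> carrier ?T" "h \<in> carrier ?T" for g h
    using that sub closed
    by (auto simp: twin_conj_def compose_def fun_eq_iff N.inv_mult_group N.m_assoc)
  have bij: "twin_conj n g \<in> Bij (carrier ?P)" if g: "g \<in> carrier ?T" for g
  proof -
    have "bij_betw (twin_conj n g) (carrier ?P) (carrier ?P)"
    proof (rule bij_betwI[where g = "twin_conj n (inv\<^bsub>?T\<^esub> g)"])
      show "twin_conj n g \<in> carrier ?P \<rightarrow> carrier ?P"
        "twin_conj n (inv\<^bsub>?T\<^esub> g) \<in> carrier ?P \<rightarrow> carrier ?P"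
        using closed closed' g by (auto simp: twin_conj_def)
      have one: "twin_conj n \<one>\<^bsub>?T\<^esub> x = x" if "x \<in> carrier ?P" for x
        using that sub by (simp add: twin_conj_def)
      show "twin_conj n (inv\<^bsub>?T\<^esub> g) (twin_conj n g x) = x" if "x \<in> carrier ?P" for x
        using comp[of g "inv\<^bsub>?T\<^esub> g"] g that one[OF that] by (simp add: compose_def fun_eq_iff)
      show "twin_conj n g (twin_conj n (inv\<^bsub>?T\<^esub> g) x) = x" if "x \<in> carrier ?P" for x
        using comp[of "inv\<^bsub>?T\<^esub> g" g] g that one[OF that] by (simp add: compose_def fun_eq_iff)
    qed
    then show ?thesis by (simp add: Bij_def twin_conj_def)
  qed
  have hom: "twin_conj n g \<in> hom ?P ?P" if g: "g \<in> carrier ?T" for g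
  proof (rule homI)
    show "twin_conj n g x \<in> carrier ?P" if "x \<in> carrier ?P" for x
      using closed g that by (simp add: twin_conj_def)
    show "twin_conj n g (x \<otimes>\<^bsub>?P\<^esub> y) = twin_conj n g x \<otimes>\<^bsub>?P\<^esub> twin_conj n g y"
      if xy: "x \<in> carrier ?P" "y \<in> carrier ?P" for x y
    proof -
      have "g \<otimes>\<^bsub>?T\<^esub> (inv\<^bsub>?T\<^esub> g \<otimes>\<^bsub>?T\<^esub> z) = z" if "z \<in> carrier ?T" for z
        using g that by (simp add: N.m_assoc[symmetric])
      then show ?thesis
        using xy sub g by (simp add: twin_conj_def P_mult N.m_assoc)
    qed
  qed
  show ?thesis
  proof (rule homI)
    show "twin_conj n g \<in> carrier (aut_pure_twin_group n)" if "g \<in> carrier ?T" for g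
      using hom[OF that] bij[OF that] by (simp add: aut_pure_twin_group_def AutoGroup_def auto_def)
    show "twin_conj n (g \<otimes>\<^bsub>?T\<^esub> h) =
        twin_conj n g \<otimes>\<^bsub>aut_pure_twin_group n\<^esub> twin_conj n h"
      if "g \<in> carrier ?T" "h \<in> carrier ?T" for g h
      using comp[OF that] bij that
      by (simp add: aut_pure_twin_group_def AutoGroup_def BijGroup_def)
  qed
qed

end

(*
  T_n acts on integer sequences by v_i := 3 (v_(i-1) + v_(i+1)) - v_i. Dually, an element w determines
  the numbers (num n w j), and multiplying w by s_i on the right negates the i-th number and adds three
  times its old value to its neighbours (Mozes' numbers game, started from the all-ones position).
  If only positive numbers are fired, each negative number always has neighbours of at least the same
  absolute value; hence every element has a word whose letters all fire positive numbers, and a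
  nonempty word of this kind leaves a negative number next to a positive one.

  An element centralizing PT_n commutes with the pure elements (s_i s_(i+1))^3. For n >= 4 this forces
  it to act as a scalar, so its numbers are all equal and its word is empty. For n = 2 the group T_n is
  abelian, and for n = 3 the element s_1 s_2 commutes with all words of even length, hence with PT_3.
*)

theory Submission
  imports Defs
begin

section \<open>Positive words for twin groups\<close>

definition twin_word :: "nat \<Rightarrow> nat list \<Rightarrow> nat group_word set"
  where "twin_word n w = word_cong {1..<n} (twin_relations n) `` {map (\<lambda>i. (i, True)) w}"

lemma positive_group_word: "w \<in> lists S \<Longrightarrow> map (\<lambda>i. (i, True)) w \<in> group_words S"
  by auto

lemma twin_word_closed: "w \<in> lists {1..<n} \<Longrightarrow> twin_word n w \<in> carrier (twin_group n)"
  unfolding twin_word_def twin_group_def by (intro presented_carrierI positive_group_word)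

lemma twin_word_append:
  assumes "u \<in> lists {1..<n}" "v \<in> lists {1..<n}"
  shows "twin_word n (u @ v) = twin_word n u \<otimes>\<^bsub>twin_group n\<^esub> twin_word n v"
  unfolding twin_word_def twin_group_def
  by (simp only: presented_mult[OF positive_group_word[OF assms(1)] positive_group_word[OF assms(2)]]
      map_append)

lemma twin_word_Nil: "twin_word n [] = \<one>\<^bsub>twin_group n\<^esub>"
  by (simp add: twin_word_def twin_group_def presented_one)

lemma twin_word_square:
  assumes "i \<in> {1..<n}"
  shows "twin_word n [i, i] = \<one>\<^bsub>twin_group n\<^esub>"
proof -
  have "([(i, True), (i, True)], []) \<in> word_cong {1..<n} (twin_relations n)"
    using assms by (intro word_cong.relation) (auto simp: twin_relations_def)
  then show ?thesis
    using equiv_class_eq[OF equiv_word_cong]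
    by (fastforce simp: twin_word_def twin_word_Nil[symmetric])
qed

lemma twin_word_commute:
  assumes "i \<in> {1..<n}" "j \<in> {1..<n}" "\<bar>int i - int j\<bar> \<ge> 2"
  shows "twin_word n [i, j] = twin_word n [j, i]"
proof -
  have "([(i, True), (j, True)], [(j, True), (i, True)]) \<in> word_cong {1..<n} (twin_relations n)"
    using assms by (intro word_cong.relation) (auto simp: twin_relations_def)
  then show ?thesis
    using equiv_class_eq[OF equiv_word_cong] by (fastforce simp: twin_word_def)
qed

lemma word_cong_twin_positive:
  assumes "u \<in> group_words {1..<n}"
  shows "(u, map (\<lambda>i. (i, True)) (map fst u)) \<in> word_cong {1..<n} (twin_relations n)"
  using assms
proof (induction u)
  case Nil
  then show ?case by (auto intro: word_cong.refl)
next
  case (Cons l u)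
  let ?W = "word_cong {1..<n} (twin_relations n)"
  obtain i b where l: "l = (i, b)" "i \<in> {1..<n}" using Cons.hyps by blast
  have "([(i, b)], [(i, True)]) \<in> ?W"
  proof (cases b)
    case True
    then show ?thesis using l by (auto intro: word_cong.refl)
  next
    case False
    have "([(i, True), (i, True)], []) \<in> ?W"
      using l by (intro word_cong.relation) (auto simp: twin_relations_def)
    \<comment> \<open>The word s^-1 s s reduces to s^-1 by the relation and to s by free
      cancellation.\<close>
    then have "([(i, False)] @ [(i, True), (i, True)], [(i, False)] @ []) \<in> ?W"
      using l by (intro word_cong.append word_cong.refl) auto
    moreover have "([(i, False), (i, True)] @ [(i, True)], [] @ [(i, True)]) \<in> ?W"
      using l word_cong.cancel[of i _ False]
      by (intro word_cong.append word_cong.refl) auto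
    ultimately show ?thesis
      using False by (auto intro: word_cong.trans word_cong.sym)
  qed
  then have "([(i, b)] @ u, [(i, True)] @ map (\<lambda>i. (i, True)) (map fst u)) \<in> ?W"
    using Cons by (intro word_cong.append) auto
  then show ?case using l by simp
qed

lemma twin_groupE:
  assumes "g \<in> carrier (twin_group n)"
  obtains w where "w \<in> lists {1..<n}" "g = twin_word n w"
proof -
  obtain u where u: "u \<in> group_words {1..<n}" "g = word_cong {1..<n} (twin_relations n) `` {u}"
    using assms unfolding twin_group_def by (rule presented_carrierE)
  have "g = twin_word n (map fst u)"
    unfolding twin_word_def u(2)
    by (rule equiv_class_eq[OF equiv_word_cong word_cong_twin_positive[OF u(1)]])
  moreover have "map fst u \<in> lists {1..<n}" using u(1) by fastforce
  ultimately show ?thesis using that by blast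
qed

lemma twin_word_eqD:
  assumes "twin_word n u = twin_word n v" "v \<in> lists {1..<n}"
  shows "(map (\<lambda>i. (i, True)) u, map (\<lambda>i. (i, True)) v) \<in> word_cong {1..<n} (twin_relations n)"
  using eq_equiv_class[OF assms(1)[unfolded twin_word_def] equiv_word_cong
      positive_group_word[OF assms(2)]] .

section \<open>Permutation images, parity, and the kernel of \<open>twin_conj\<close>\<close>

lemma twin_perm_word:
  assumes "w \<in> lists {1..<n}"
  shows "twin_perm n (twin_word n w) = foldr (\<lambda>i p. transpose i (i + 1) \<circ> p) w id"
proof -
  have "twin_perm n (twin_word n w) =
      eval_word (sym_group n) (\<lambda>i. transpose i (i + 1)) (map (\<lambda>i. (i, True)) w)"
    unfolding twin_perm_def twin_word_def
    by (intro presented_lift_class sym_group_is_group transpose_in_sym_group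
        transposes_respect_twin_relations positive_group_word assms)
  also have "\<dots> = foldr (\<lambda>i p. transpose i (i + 1) \<circ> p) w id"
    by (induction w) (simp_all add: eval_word_def eval_letter_def sym_group_mult sym_group_one)
  finally show ?thesis .
qed

text \<open>\<open>permutation\<close> is carried through the induction because multiplicativity of
  \<open>sign\<close> requires it.\<close>

lemma sign_foldr_transpose:
  fixes w :: "nat list"
  shows "permutation (foldr (\<lambda>i p. transpose i (i + 1) \<circ> p) w id) \<and>
    sign (foldr (\<lambda>i p. transpose i (i + 1) \<circ> p) w id) = (-1) ^ length w"
proof (induction w)
  case (Cons i w)
  have "permutation (transpose i (i + 1) \<circ> p) \<and>
      sign (transpose i (i + 1) \<circ> p) = - ((-1) ^ length w)"
    if "permutation p \<and> sign p = (-1) ^ length w" for p :: "nat \<Rightarrow> nat"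
    using that permutation_swap_id[of i "i + 1"]
    by (simp add: permutation_compose sign_compose sign_swap_id)
  from this[OF Cons.IH] show ?case by (simp add: comp_def)
qed simp

lemma pure_twin_carrier:
  "g \<in> carrier (pure_twin_group n) \<longleftrightarrow> g \<in> carrier (twin_group n) \<and> twin_perm n g = id"
  by (simp add: pure_twin_group_def kernel_def sym_group_one)

lemma pure_twin_word_even:
  assumes "w \<in> lists {1..<n}" "twin_word n w \<in> carrier (pure_twin_group n)"
  shows "even (length w)"
proof -
  have "foldr (\<lambda>i p. transpose i (i + 1) \<circ> p) w id = id"
    using assms by (simp add: pure_twin_carrier twin_perm_word del: foldr_conv_fold)
  then have "(-1 :: int) ^ length w = 1"
    using sign_foldr_transpose[of w] by simp
  then show ?thesis by (simp add: minus_one_power_iff split: if_splits)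
qed

text \<open>Turns the kernel into the centralizer of the pure twin group, the form in which both
  directions of the theorem treat it.\<close>

lemma twin_conj_eq_one_iff:
  assumes "g \<in> carrier (twin_group n)"
  shows "twin_conj n g = twin_conj n \<one>\<^bsub>twin_group n\<^esub> \<longleftrightarrow>
    (\<forall>x \<in> carrier (pure_twin_group n). x \<otimes>\<^bsub>twin_group n\<^esub> g = g \<otimes>\<^bsub>twin_group n\<^esub> x)"
proof -
  interpret group "twin_group n" by (rule twin_group_is_group)
  have "inv\<^bsub>twin_group n\<^esub> g \<otimes>\<^bsub>twin_group n\<^esub> x \<otimes>\<^bsub>twin_group n\<^esub> g = x \<longleftrightarrow>
      x \<otimes>\<^bsub>twin_group n\<^esub> g = g \<otimes>\<^bsub>twin_group n\<^esub> x"
    if "x \<in> carrier (pure_twin_group n)" for x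
  proof -
    have "x \<in> carrier (twin_group n)" using that by (simp add: pure_twin_carrier)
    then show ?thesis using assms
      by (metis inv_closed inv_solve_left m_assoc m_closed)
  qed
  then show ?thesis
    using pure_twin_carrier by (auto simp: twin_conj_def fun_eq_iff restrict_def)
qed


section \<open>The cases of two and three strands\<close>

lemma twin_word_2_commute:
  assumes "w \<in> lists {1..<2}"
  shows "twin_word 2 w \<otimes>\<^bsub>twin_group 2\<^esub> twin_word 2 [1] =
    twin_word 2 [1] \<otimes>\<^bsub>twin_group 2\<^esub> twin_word 2 w"
proof -
  have "w = replicate (length w) 1"
    using assms by (induction w) auto
  then have "w @ [1] = [1] @ w"
    by (metis replicate_append_same append_Cons append_Nil)
  then show ?thesis
    using assms twin_word_append[of w 2 "[1]"] twin_word_append[of "[1]" 2 w] by simp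
qed

text \<open>Cut into blocks of two letters, the word becomes a product of copies of 1, r and the
  inverse of r, where r is the class of \<open>[1, 2]\<close>.\<close>

lemma even_twin_word_3_commute:
  assumes "w \<in> lists {1..<3}" "even (length w)"
  shows "twin_word 3 w \<otimes>\<^bsub>twin_group 3\<^esub> twin_word 3 [1, 2] =
    twin_word 3 [1, 2] \<otimes>\<^bsub>twin_group 3\<^esub> twin_word 3 w"
  using assms
proof (induction w rule: induct_list012)
  interpret T: group "twin_group 3" by (rule twin_group_is_group)
  let ?r = "twin_word 3 [1, 2]"
  have r: "?r \<in> carrier (twin_group 3)" by (intro twin_word_closed) auto
  {
    case 1
    then show ?case using r by (simp add: twin_word_Nil)
  next
    case (2 x)
    then show ?case by simp
  next
    case (3 i j w)
    have sq: "twin_word 3 [i, i] = \<one>\<^bsub>twin_group 3\<^esub>" if "i \<in> {1..<3}" for i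
      using twin_word_square[OF that] .
    have split: "twin_word 3 [i, j] = twin_word 3 [i] \<otimes>\<^bsub>twin_group 3\<^esub> twin_word 3 [j]"
      if "i \<in> {1..<3}" "j \<in> {1..<3}" for i j
      using twin_word_append[of "[i]" 3 "[j]"] that by simp
    have inv: "twin_word 3 [2, 1] \<otimes>\<^bsub>twin_group 3\<^esub> ?r = \<one>\<^bsub>twin_group 3\<^esub>"
      "?r \<otimes>\<^bsub>twin_group 3\<^esub> twin_word 3 [2, 1] = \<one>\<^bsub>twin_group 3\<^esub>"
    proof -
      have c: "twin_word 3 [1] \<in> carrier (twin_group 3)" "twin_word 3 [2] \<in> carrier (twin_group 3)"
        by (auto intro: twin_word_closed)
      have a: "twin_word 3 [1] \<otimes>\<^bsub>twin_group 3\<^esub> twin_word 3 [1] = \<one>\<^bsub>twin_group 3\<^esub>"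
        "twin_word 3 [2] \<otimes>\<^bsub>twin_group 3\<^esub> twin_word 3 [2] = \<one>\<^bsub>twin_group 3\<^esub>"
        using sq[of 1] sq[of 2] split[of 1 1] split[of 2 2] by simp_all
      show "twin_word 3 [2, 1] \<otimes>\<^bsub>twin_group 3\<^esub> ?r = \<one>\<^bsub>twin_group 3\<^esub>"
        "?r \<otimes>\<^bsub>twin_group 3\<^esub> twin_word 3 [2, 1] = \<one>\<^bsub>twin_group 3\<^esub>"
        using c a split[of 1 2] split[of 2 1]
        by (simp_all, (metis T.m_assoc T.m_closed T.r_one)+)
    qed
    have ij: "i \<in> {1, 2}" "j \<in> {1, 2}" and w: "w \<in> lists {1..<3}" "even (length w)"
      using 3(3,4) by auto
    have "twin_word 3 [i, j] \<otimes>\<^bsub>twin_group 3\<^esub> ?r = ?r \<otimes>\<^bsub>twin_group 3\<^esub> twin_word 3 [i, j]"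
      using ij sq[of 1] sq[of 2] inv r by auto
    moreover have "twin_word 3 (i # j # w) = twin_word 3 [i, j] \<otimes>\<^bsub>twin_group 3\<^esub> twin_word 3 w"
      using twin_word_append[of "[i, j]" 3 w] ij w by auto
    moreover have "twin_word 3 [i, j] \<in> carrier (twin_group 3)"
      using ij by (intro twin_word_closed) auto
    ultimately show ?case
      using 3(1)[OF w] twin_word_closed[OF w(1)] r by (metis T.m_assoc)
  }
qed

lemma not_inj_twin_conj:
  assumes "n = 2 \<or> n = 3"
  shows "\<not> inj_on (twin_conj n) (carrier (twin_group n))"
proof -
  interpret group "twin_group n" by (rule twin_group_is_group)
  define w where "w = (if n = 2 then [1] else [1, 2 :: nat])"
  have w: "w \<in> lists {1..<n}" using assms by (auto simp: w_def)
  have "twin_conj n (twin_word n w) = twin_conj n \<one>\<^bsub>twin_group n\<^esub>"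
    unfolding twin_conj_eq_one_iff[OF twin_word_closed[OF w]]
  proof
    fix x assume x: "x \<in> carrier (pure_twin_group n)"
    then obtain v where v: "v \<in> lists {1..<n}" "x = twin_word n v"
      by (metis pure_twin_carrier twin_groupE)
    have "even (length v)" using pure_twin_word_even v x by blast
    then show "x \<otimes>\<^bsub>twin_group n\<^esub> twin_word n w = twin_word n w \<otimes>\<^bsub>twin_group n\<^esub> x"
      using assms v twin_word_2_commute even_twin_word_3_commute by (auto simp: w_def)
  qed
  moreover have "twin_word n w \<noteq> \<one>\<^bsub>twin_group n\<^esub>"
  proof
    assume "twin_word n w = \<one>\<^bsub>twin_group n\<^esub>"
    then have "twin_perm n (twin_word n w) = twin_perm n (twin_word n [])"
      by (simp add: twin_word_Nil)
    then have "foldr (\<lambda>i p. transpose i (i + 1) \<circ> p) w id 1 = (1 :: nat)"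
      using w by (simp add: twin_perm_word del: foldr_conv_fold)
    \<comment> \<open>For either choice of \<open>w\<close> the permutation sends 1 to 2.\<close>
    then show False
      by (simp add: w_def Transposition.transpose_def split: if_splits)
  qed
  ultimately show ?thesis
    using twin_word_closed[OF w] by (meson inj_onD one_closed)
qed


section \<open>A reflection representation\<close>

text \<open>In coordinates with respect to simple roots, a Coxeter reflection for Cartan entries -3
  between neighbours. With -2 the product of two adjacent reflections would be unipotent on the
  plane of their roots; with -3 its cube has no eigenvalue 1 there, which
  \<open>act_unit_outside\<close> exploits.\<close>

definition reflect :: "nat \<Rightarrow> (nat \<Rightarrow> int) \<Rightarrow> nat \<Rightarrow> int"
  where "reflect i v = v(i := 3 * (v (i - 1) + v (i + 1)) - v i)"

definition act :: "nat list \<Rightarrow> (nat \<Rightarrow> int) \<Rightarrow> nat \<Rightarrow> int"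
  where "act w = foldr reflect w"

definition unit :: "nat \<Rightarrow> nat \<Rightarrow> int"
  where "unit j = (\<lambda>l. of_bool (l = j))"

lemma act_simps: "act [] v = v" "act (i # w) v = reflect i (act w v)"
  by (simp_all add: act_def)

lemma act_append: "act (u @ v) x = act u (act v x)"
  by (simp add: act_def)

text \<open>At position 0 truncated subtraction would make the position its own neighbour, hence
  \<open>i \<ge> 1\<close>.\<close>

lemma reflect_reflect: "i \<ge> 1 \<Longrightarrow> reflect i (reflect i v) = v"
  by (auto simp: reflect_def fun_eq_iff)

lemma reflect_commute: "\<bar>int i - int j\<bar> \<ge> 2 \<Longrightarrow> reflect i (reflect j v) = reflect j (reflect i v)"
  by (auto simp: reflect_def fun_eq_iff)

lemma act_linear:
  "act w (\<lambda>l. a * u l + b * v l) = (\<lambda>l. a * act w u l + b * act w v l)"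
  by (induction w) (auto simp: act_simps reflect_def fun_eq_iff algebra_simps)

lemma act_scale: "act w (\<lambda>l. a * u l) = (\<lambda>l. a * act w u l)"
  using act_linear[of w a u 0 u] by simp

text \<open>Forgetting signs by \<open>map fst\<close> respects free cancellation because
  reflections are involutions.\<close>

lemma word_cong_act:
  "(u, v) \<in> word_cong {1..<n} (twin_relations n) \<Longrightarrow> act (map fst u) = act (map fst v)"
proof (induction rule: word_cong.induct)
  case (relation u v)
  then show ?case
    by (auto simp: twin_relations_def act_simps fun_eq_iff reflect_reflect reflect_commute)
qed (simp_all add: act_append act_simps fun_eq_iff[where 'b = "nat \<Rightarrow> int"] reflect_reflect)

lemma twin_word_act:
  assumes "twin_word n u = twin_word n v" "v \<in> lists {1..<n}"
  shows "act u = act v"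
  using word_cong_act[OF twin_word_eqD[OF assms]] by (simp add: comp_def)


section \<open>The numbers game\<close>

text \<open>For letters and \<open>j\<close> in range, this is the height of the root that
  \<open>w\<close> makes of the simple root \<open>unit j\<close>.\<close>

definition num :: "nat \<Rightarrow> nat list \<Rightarrow> nat \<Rightarrow> int"
  where "num n w j = (\<Sum>l \<in> {1..<n}. act w (unit j) l)"

lemma reflect_unit:
  assumes "i \<ge> 1"
  shows "reflect i (unit j) = (if i = j then (\<lambda>l. -1 * unit j l)
    else if \<bar>int i - int j\<bar> = 1 then (\<lambda>l. 1 * unit j l + 3 * unit i l) else unit j)"
  using assms by (auto simp: reflect_def unit_def fun_eq_iff)

text \<open>The last letter acts first, directly on \<open>unit j\<close>; linearity of
  \<open>act w\<close> then gives the firing rule.\<close>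

lemma num_snoc:
  assumes "i \<ge> 1"
  shows "num n (w @ [i]) j = (if i = j then - num n w j
    else if \<bar>int i - int j\<bar> = 1 then num n w j + 3 * num n w i else num n w j)"
  unfolding num_def act_append act_simps reflect_unit[OF assms]
  by (simp only: act_linear act_scale sum.distrib sum_distrib_left[symmetric] split: if_split) auto

lemma num_Nil: "j \<in> {1..<n} \<Longrightarrow> num n [] j = 1"
  by (simp add: num_def act_simps unit_def)

inductive_set game_words :: "nat \<Rightarrow> nat list set" for n where
  Nil: "[] \<in> game_words n"
| snoc: "w \<in> game_words n \<Longrightarrow> i \<in> {1..<n} \<Longrightarrow> num n w i > 0 \<Longrightarrow> w @ [i] \<in> game_words n"

lemma game_words_lists: "w \<in> game_words n \<Longrightarrow> w \<in> lists {1..<n}"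
  by (induction rule: game_words.induct) auto

text \<open>The bound by neighbours sustains the induction: when c > 0 is fired, each neighbour was
  at least -c and becomes at least 2c, while the fired position becomes -c.\<close>

lemma game_words_num:
  assumes "w \<in> game_words n" "j \<in> {1..<n}"
  shows "num n w j \<noteq> 0"
    and "\<And>l. l \<in> {1..<n} \<Longrightarrow> \<bar>int j - int l\<bar> = 1 \<Longrightarrow> num n w j < 0 \<Longrightarrow> - num n w j \<le> num n w l"
proof -
  have "num n w j \<noteq> 0 \<and> (\<forall>l \<in> {1..<n}. \<bar>int j - int l\<bar> = 1 \<longrightarrow> num n w j < 0 \<longrightarrow> - num n w j \<le> num n w l)"
    using assms
  proof (induction arbitrary: j rule: game_words.induct)
    case Nil
    then show ?case by (simp add: num_Nil)
  next
    case (snoc w i)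
    have i: "i \<ge> 1" using snoc by simp
    have adj: "num n (w @ [i]) l \<ge> num n w i"
      if "l \<in> {1..<n}" "\<bar>int i - int l\<bar> = 1" for l
    proof -
      have "- num n w l \<le> num n w i" if "num n w l < 0"
        using snoc.IH[of l] snoc.hyps that \<open>l \<in> _\<close> \<open>\<bar>int i - int l\<bar> = 1\<close> by auto
      then show ?thesis
        using that snoc.hyps by (cases "num n w l < 0") (auto simp: num_snoc[OF i])
    qed
    have ge: "num n (w @ [i]) l \<ge> num n w l" if "l \<noteq> i" for l
      using that snoc.hyps by (simp add: num_snoc[OF i])
    consider "j = i" | "\<bar>int i - int j\<bar> = 1" | "j \<noteq> i" "\<bar>int i - int j\<bar> \<noteq> 1" by blast
    then show ?case
    proof cases
      case 1
      then show ?thesis using snoc.hyps adj by (auto simp: num_snoc[OF i])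
    next
      case 2
      then show ?thesis using adj[of j] snoc by auto
    next
      case 3
      then have eq: "num n (w @ [i]) j = num n w j" by (simp add: num_snoc[OF i])
      \<comment> \<open>Only position \<open>i\<close> loses value, and it is not a neighbour of
        \<open>j\<close>, so the old bound survives.\<close>
      have "- num n w j \<le> num n (w @ [i]) l"
        if "l \<in> {1..<n}" "\<bar>int j - int l\<bar> = 1" "num n w j < 0" for l
      proof -
        have "l \<noteq> i" using that 3 by auto
        then show ?thesis using ge[of l] snoc.IH[OF snoc.prems] that by force
      qed
      then show ?thesis using eq snoc.IH[OF snoc.prems] by auto
    qed
  qed
  then show "num n w j \<noteq> 0"
    and "\<And>l. l \<in> {1..<n} \<Longrightarrow> \<bar>int j - int l\<bar> = 1 \<Longrightarrow> num n w j < 0 \<Longrightarrow> - num n w j \<le> num n w l"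
    by auto
qed

text \<open>The letter \<open>i\<close> moves left past commuting letters until it cancels against
  an equal one. A neighbouring letter cannot block it, since adjacent positions are never both
  negative.\<close>

lemma game_words_fire_negative:
  assumes "w \<in> game_words n" "i \<in> {1..<n}" "num n w i < 0"
  shows "\<exists>v \<in> game_words n. twin_word n v = twin_word n (w @ [i])"
  using assms
proof (induction rule: game_words.induct)
  case Nil
  then show ?case by (simp add: num_Nil)
next
  case (snoc w j)
  interpret group "twin_group n" by (rule twin_group_is_group)
  have w: "w \<in> lists {1..<n}" using snoc game_words_lists by blast
  have j: "j \<ge> 1" using snoc by simp
  have split: "twin_word n ((w @ [j]) @ [i]) = twin_word n w \<otimes>\<^bsub>twin_group n\<^esub> twin_word n [j, i]"
    using twin_word_append[OF w, of "[j, i]"] snoc by simp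
  consider "j = i" | "\<bar>int j - int i\<bar> = 1" | "j \<noteq> i" "\<bar>int j - int i\<bar> \<ge> 2" by linarith
  then show ?case
  proof cases
    case 1
    then have "twin_word n w = twin_word n ((w @ [j]) @ [i])"
      using split snoc twin_word_square[of i n] twin_word_closed[OF w] by simp
    then show ?thesis using snoc by blast
  next
    case 2
    have "w @ [j] \<in> game_words n" using snoc by (intro game_words.snoc)
    then have "- num n (w @ [j]) i \<le> num n (w @ [j]) j"
      using game_words_num(2)[of "w @ [j]" n i j] snoc 2 by auto
    then show ?thesis using snoc by (simp add: num_snoc[OF j])
  next
    case 3
    then have neg: "num n w i < 0" using snoc by (simp add: num_snoc[OF j])
    then obtain v where v: "v \<in> game_words n" "twin_word n v = twin_word n (w @ [i])"
      using snoc by auto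
    have i: "w @ [i] \<in> lists {1..<n}" "i \<ge> 1" using w snoc by auto
    \<comment> \<open>\<open>num\<close> depends only on the group element, so \<open>j\<close> may
      still be fired after replacing \<open>w @ [i]\<close> by \<open>v\<close>.\<close>
    have "num n v j = num n (w @ [i]) j"
      unfolding num_def twin_word_act[OF v(2) i(1)] ..
    also have "\<dots> = num n w j" using 3 by (auto simp: num_snoc[OF i(2)])
    finally have "v @ [j] \<in> game_words n" using v snoc by (intro game_words.snoc) auto
    moreover have "twin_word n (v @ [j]) = twin_word n ((w @ [j]) @ [i])"
    proof -
      have "twin_word n (v @ [j]) = twin_word n v \<otimes>\<^bsub>twin_group n\<^esub> twin_word n [j]"
        using game_words_lists[OF v(1)] snoc by (intro twin_word_append) auto
      also have "\<dots> = twin_word n ((w @ [i]) @ [j])"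
        unfolding v(2) using i snoc by (intro twin_word_append[symmetric]) auto
      also have "\<dots> = twin_word n w \<otimes>\<^bsub>twin_group n\<^esub> twin_word n [i, j]"
        using twin_word_append[OF w, of "[i, j]"] snoc by simp
      also have "\<dots> = twin_word n ((w @ [j]) @ [i])"
        unfolding split using twin_word_commute[of i n j] 3 snoc by auto
      finally show ?thesis .
    qed
    ultimately show ?thesis by blast
  qed
qed

lemma ex_game_word:
  assumes "w \<in> lists {1..<n}"
  shows "\<exists>v \<in> game_words n. twin_word n v = twin_word n w"
  using assms
proof (induction w rule: rev_induct)
  case Nil
  then show ?case by (blast intro: game_words.Nil)
next
  case (snoc i w)
  then obtain v where v: "v \<in> game_words n" "twin_word n v = twin_word n w" by auto
  have i: "i \<in> {1..<n}" and w: "w \<in> lists {1..<n}" using snoc by auto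
  have "twin_word n (v @ [i]) = twin_word n (w @ [i])"
    using twin_word_append[of v n "[i]"] twin_word_append[of w n "[i]"] v i w game_words_lists
    by auto
  then show ?case
    using game_words_fire_negative[OF v(1) i] game_words.snoc[OF v(1) i] game_words_num(1)[OF v(1) i]
    by (cases "num n v i > 0") auto
qed

lemma game_word_constant:
  assumes "w \<in> game_words n" "n \<ge> 3" "\<And>j. j \<in> {1..<n} \<Longrightarrow> num n w j = a"
  shows "w = []"
proof -
  \<comment> \<open>A negative constant would violate the neighbour bound at the adjacent positions
    1 and 2.\<close>
  have "a > 0"
    using game_words_num[OF assms(1), of 1] assms(2) assms(3)[of 1] assms(3)[of 2]
    by (force dest: spec[of _ 2])
  from assms(1) show ?thesis
  proof cases
    case (snoc u i)
    \<comment> \<open>The position fired last has just changed from positive to negative.\<close>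
    then have "num n w i < 0" by (simp add: num_snoc)
    then show ?thesis using assms(3)[of i] snoc \<open>a > 0\<close> by auto
  qed
qed


section \<open>The centralizer of the pure twin group\<close>

definition pair :: "nat \<Rightarrow> int \<Rightarrow> int \<Rightarrow> nat \<Rightarrow> int"
  where "pair i p q = (\<lambda>l. p * unit i l + q * unit (Suc i) l)"

lemma reflect_pair:
  assumes "i \<ge> 1"
  shows "reflect i (pair i p q) = pair i (3 * q - p) q"
    "reflect (Suc i) (pair i p q) = pair i p (3 * p - q)"
  using assms by (auto simp: reflect_def pair_def unit_def fun_eq_iff)

abbreviation cube :: "nat \<Rightarrow> nat list"
  where "cube i \<equiv> [i, Suc i, i, Suc i, i, Suc i]"

text \<open>On this plane \<open>[i, Suc i]\<close> has the matrix with rows (8, -3) and (3, -1).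
  Its cube has, up to sign, the Fibonacci numbers 377, 144 and 55 as entries.\<close>

lemma act_cube_pair:
  assumes "i \<ge> 1"
  shows "act (cube i) (pair i p q) = pair i (377 * p - 144 * q) (144 * p - 55 * q)"
  using assms by (simp add: act_simps reflect_pair)

lemma act_cube_outside: "l \<noteq> i \<Longrightarrow> l \<noteq> Suc i \<Longrightarrow> act (cube i) v l = v l"
  by (simp add: act_simps reflect_def)

text \<open>The product of two adjacent transpositions is a 3-cycle, so its cube is trivial.\<close>

lemma cube_pure:
  assumes "i \<ge> 1" "Suc i < n"
  shows "twin_word n (cube i) \<in> carrier (pure_twin_group n)"
proof -
  have w: "cube i \<in> lists {1..<n}" using assms by auto
  show ?thesis
    unfolding pure_twin_carrier twin_perm_word[OF w]
    using twin_word_closed[OF w] by (auto simp: fun_eq_iff Transposition.transpose_def)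
qed

lemma act_pair: "act w (pair i p q) = (\<lambda>l. p * act w (unit i) l + q * act w (unit (Suc i)) l)"
  unfolding pair_def by (rule act_linear)

text \<open>The restriction of \<open>act (cube i) - 1\<close> to the plane spanned by \<open>unit i\<close> and \<open>unit (Suc i)\<close> has
  determinant \<open>-320\<close>; the coefficients below are the columns of its adjugate, divided by \<open>8\<close>.\<close>

lemma act_unit_outside:
  assumes "i \<ge> 1" "\<And>v. act w (act (cube i) v) = act (cube i) (act w v)"
    and "j = i \<or> j = Suc i" "l \<noteq> i" "l \<noteq> Suc i"
  shows "act w (unit j) l = 0"
proof -
  obtain p q where pq: "\<And>l. -40 * unit j l = 1 * act (cube i) (pair i p q) l + (-1) * pair i p q l"
  proof (cases "j = i")
    case True
    then show ?thesis
      using that[of "-7" "-18"] act_cube_pair[OF assms(1), of "-7" "-18"]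
      by (simp add: fun_eq_iff) (simp add: pair_def)
  next
    case False
    then show ?thesis
      using assms(3) that[of 18 47] act_cube_pair[OF assms(1), of 18 47]
      by (simp add: fun_eq_iff) (simp add: pair_def)
  qed
  have "-40 * act w (unit j) l = act w (\<lambda>l. -40 * unit j l) l"
    unfolding act_scale ..
  \<comment> \<open>With C for the cube, w (C - 1) = (C - 1) w, and the image of C - 1 vanishes
    outside \<open>i\<close> and \<open>Suc i\<close>.\<close>
  also have "\<dots> = act w (act (cube i) (pair i p q)) l - act w (pair i p q) l"
    unfolding pq act_linear by simp
  also have "\<dots> = 0"
    unfolding assms(2) act_cube_outside[OF assms(4,5)] by simp
  finally show ?thesis by simp
qed

text \<open>For \<open>n \<ge> 4\<close> the vector \<open>unit 2\<close> lies in the planes for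
  \<open>i = 1\<close> and \<open>i = 2\<close>, so its image is supported on their common position.
  The nonzero off-diagonal entries of the cubes spread the eigenvalue to all other
  positions.\<close>

lemma act_scalar:
  assumes "n \<ge> 4"
    and comm: "\<And>i v. i \<ge> 1 \<Longrightarrow> Suc i < n \<Longrightarrow> act w (act (cube i) v) = act (cube i) (act w v)"
  obtains a where "\<And>j. j \<in> {1..<n} \<Longrightarrow> act w (unit j) = (\<lambda>l. a * unit j l)"
proof -
  define a where "a = act w (unit 2) 2"
  have two: "act w (unit 2) = (\<lambda>l. a * unit 2 l)"
  proof
    fix l
    have "l \<noteq> 1 \<Longrightarrow> l \<noteq> 2 \<Longrightarrow> act w (unit 2) l = 0"
      using act_unit_outside[of 1 w 2 l] comm[of 1] assms(1) by (simp add: numeral_2_eq_2)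
    moreover have "l \<noteq> 2 \<Longrightarrow> l \<noteq> 3 \<Longrightarrow> act w (unit 2) l = 0"
      using act_unit_outside[of 2 w 2 l] comm[of 2] assms(1) by simp
    moreover have "unit 2 l = of_bool (l = 2)" by (simp add: unit_def)
    ultimately show "act w (unit 2) l = a * unit 2 l"
      by (cases "l = 2"; cases "l = 1") (auto simp: a_def)
  qed
  have step: "p * act w (unit i) l + q * act w (unit (Suc i)) l = act (cube i) (act w (unit j)) l"
    if "1 \<le> i" "Suc i < n" "act (cube i) (unit j) = pair i p q" for i j p q l
    using comm[OF that(1,2), of "unit j", symmetric] that(3) act_pair by simp
  have scaled: "act (cube i) (\<lambda>l. a * unit j l) = (\<lambda>l. a * pair i p q l)"
    if "act (cube i) (unit j) = pair i p q" for i j p q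
    using that act_scale by simp
  have up: "act w (unit (Suc i)) = (\<lambda>l. a * unit (Suc i) l)"
    if "1 \<le> i" "Suc i < n" "act w (unit i) = (\<lambda>l. a * unit i l)" for i
  proof
    fix l
    have "pair i 1 0 = unit i" by (simp add: pair_def)
    then have "act (cube i) (unit i) = pair i 377 144"
      using act_cube_pair[OF that(1), of 1 0] by simp
    \<comment> \<open>Apply w to C \<open>unit i\<close> = 377 \<open>unit i\<close> + 144
      \<open>unit (Suc i)\<close>: the first term is known, and 144 can be cancelled.\<close>
    then show "act w (unit (Suc i)) l = a * unit (Suc i) l"
      using step[OF that(1,2), of i 377 144 l] scaled[of i i 377 144] that(3)
      by (simp add: pair_def algebra_simps)
  qed
  have one: "act w (unit 1) = (\<lambda>l. a * unit 1 l)"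
  proof
    fix l
    \<comment> \<open>Position 1 is reached downwards from 2, through the second column of the cube
      matrix.\<close>
    have "pair 1 0 1 = unit 2" by (simp add: pair_def numeral_2_eq_2)
    then have "act (cube 1) (unit 2) = pair 1 (-144) (-55)"
      using act_cube_pair[of 1 0 1] by simp
    then show "act w (unit 1) l = a * unit 1 l"
      using step[of 1 2 "-144" "-55" l] scaled[of 1 2 "-144" "-55"] two assms(1)
      by (simp add: pair_def algebra_simps numeral_2_eq_2)
  qed
  have "act w (unit j) = (\<lambda>l. a * unit j l)" if "1 \<le> j" "j < n" for j
    using that by (induction j rule: dec_induct) (use one up in auto)
  then show ?thesis using that[of a] by auto
qed

section \<open>Trivial centralizer and injectivity\<close>

lemma pure_twin_centralizer_trivial:
  assumes "n \<ge> 4" "g \<in> carrier (twin_group n)"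
    and comm: "\<And>x. x \<in> carrier (pure_twin_group n) \<Longrightarrow>
      x \<otimes>\<^bsub>twin_group n\<^esub> g = g \<otimes>\<^bsub>twin_group n\<^esub> x"
  shows "g = \<one>\<^bsub>twin_group n\<^esub>"
proof -
  obtain u where "u \<in> lists {1..<n}" "g = twin_word n u" using assms(2) by (rule twin_groupE)
  then obtain w where w: "w \<in> game_words n" "g = twin_word n w" using ex_game_word by metis
  have wl: "w \<in> lists {1..<n}" using game_words_lists[OF w(1)] .
  have "act w (act (cube i) v) = act (cube i) (act w v)" if "i \<ge> 1" "Suc i < n" for i v
  proof -
    have c: "cube i \<in> lists {1..<n}" using that by auto
    have "twin_word n (w @ cube i) = twin_word n (cube i @ w)"
      using comm[OF cube_pure[OF that]] twin_word_append[OF c wl] twin_word_append[OF wl c] w(2)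
      by simp
    moreover have "cube i @ w \<in> lists {1..<n}" using c wl by auto
    ultimately have "act (w @ cube i) = act (cube i @ w)" by (rule twin_word_act)
    then show ?thesis by (metis act_append)
  qed
  then obtain a where a: "\<And>j. j \<in> {1..<n} \<Longrightarrow> act w (unit j) = (\<lambda>l. a * unit j l)"
    using act_scalar[OF assms(1)] by blast
  \<comment> \<open>A scalar multiplies the coordinate sum of every unit vector, which is 1, by
    \<open>a\<close>.\<close>
  have "num n w j = a" if "j \<in> {1..<n}" for j
    using that by (simp add: num_def a) (simp add: unit_def)
  then have "w = []" using game_word_constant[OF w(1)] assms(1) by fastforce
  then show ?thesis using w by (simp add: twin_word_Nil)
qed

theorem proposition6p12:
  fixes n :: nat
  assumes "n \<ge> 2"
  shows "inj_on (twin_conj n) (carrier (twin_group n)) \<longleftrightarrow> n \<ge> 4"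
proof
  assume "inj_on (twin_conj n) (carrier (twin_group n))"
  then show "n \<ge> 4" using not_inj_twin_conj[of n] assms by force
next
  assume n: "n \<ge> 4"
  interpret group "twin_group n" by (rule twin_group_is_group)
  show "inj_on (twin_conj n) (carrier (twin_group n))"
  proof (rule inj_onI)
    fix g h assume gh: "g \<in> carrier (twin_group n)" "h \<in> carrier (twin_group n)"
      and eq: "twin_conj n g = twin_conj n h"
    let ?k = "g \<otimes>\<^bsub>twin_group n\<^esub> inv\<^bsub>twin_group n\<^esub> h"
    \<comment> \<open>Since \<open>twin_conj\<close> is a homomorphism, \<open>g\<close> may be
      replaced by \<open>h\<close> inside \<open>?k\<close>, which puts \<open>?k\<close> in the
      kernel.\<close>
    have "twin_conj n ?k = twin_conj n (h \<otimes>\<^bsub>twin_group n\<^esub> inv\<^bsub>twin_group n\<^esub> h)"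
      using gh eq hom_mult[OF twin_conj_hom] by (metis inv_closed)
    then have "twin_conj n ?k = twin_conj n \<one>\<^bsub>twin_group n\<^esub>"
      using gh by simp
    then have "?k = \<one>\<^bsub>twin_group n\<^esub>"
      using gh n by (intro pure_twin_centralizer_trivial) (simp_all add: twin_conj_eq_one_iff)
    then show "g = h" using gh by (metis inv_equality inv_inv inv_closed)
  qed
qed

end
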